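(* Let $n,q\in\mathbb{N}$, $\alpha,\beta\in\,]-1,+\infty[$, $h>0$, let $I\subset\mathbb{R}$ be an open interval and let $f\in\mathcal{C}^{n}(I)$. Then for all $x\in I_h$ and $t\in[0,1]$, $$D^{(n)}_{h,\alpha,\beta,q}f(x-th)=\frac{1}{(-h)^n}\frac{d^n}{dt^n}\left[D^{(0)}_{h,\alpha,\beta,q}f(x-th)\right].$$ Moreover, for all $x\in I_h$ and $t\in[0,1]$, $$D^{(n)}_{h,\alpha,\beta,q}f(x-th)=\frac{1}{(-h)^n}\int_0^1 Q_{\alpha,\beta,n,q,t}(\tau)\,f(x-h\tau)\,d\tau,$$ where $$Q_{\alpha,\beta,n,q,t}(\tau)=w_{\alpha,\beta}(\tau)\sum_{i=0}^{q}C_{\alpha,\beta,n,i}\,P_i^{(\alpha+n,\beta+n)}(t)\,P_{n+i}^{(\alpha,\beta)}(\tau),$$ $$C_{\alpha,\beta,n,i}=\frac{(\beta+\alpha+2n+2i+1)\,\Gamma(\beta+\alpha+2n+i+1)\,\Gamma(n+i+1)}{\Gamma(\beta+n+i+1)\,\Gamma(\alpha+n+i+1)}.$$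
   Context: $\mathbb{N}$ contains $0$. $I_h:=\{x\in I:\ [x-h,x]\subset I\}$. For $a,b\in\,]-1,+\infty[$ and $k\in\mathbb{N}$, the Jacobi polynomial on $[0,1]$ is $$P_k^{(a,b)}(t)=\sum_{j=0}^{k}\binom{k+a}{j}\binom{k+b}{k-j}(t-1)^{k-j}t^{j},$$ with generalized binomial coefficients $\binom{r}{j}=\frac{r(r-1)\cdots(r-j+1)}{j!}$. The weight is $w_{a,b}(t)=(1-t)^{a}t^{b}$, and for $g_1,g_2\in\mathcal{C}([0,1])$, $\langle g_1(\cdot),g_2(\cdot)\rangle_{a,b}:=\int_0^1 w_{a,b}(t)g_1(t)g_2(t)\,dt$, with associated norm $\|\cdot\|_{a,b}$. For $f\in\mathcal{C}^n(I)$, $x\in I_h$ and $t\in[0,1]$, define the $q$-th order truncated Jacobi series of $t\mapsto f^{(n)}(x-ht)$, $$D^{(n)}_{h,\alpha,\beta,q}f(x-th):=\sum_{i=0}^{q}\frac{\langle P_i^{(\alpha+n,\beta+n)}(\cdot),f^{(n)}(x-h\,\cdot)\rangle_{\alpha+n,\beta+n}}{\|P_i^{(\alpha+n,\beta+n)}\|^2_{\alpha+n,\beta+n}}\,P_i^{(\alpha+n,\beta+n)}(t),$$ and the $(q+n)$-th order truncated Jacobi series of $t\mapsto f(x-ht)$ ($n$ being fixed), $$D^{(0)}_{h,\alpha,\beta,q}f(x-th):=\sum_{i=0}^{q+n}\frac{\langle P_i^{(\alpha,\beta)}(\cdot),f(x-h\,\cdot)\rangle_{\alpha,\beta}}{\|P_i^{(\alpha,\beta)}\|^2_{\alpha,\beta}}\,P_i^{(\alpha,\beta)}(t).$$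 Here $f^{(n)}(x-h\,\cdot)$ denotes the $n$-th derivative of $f$ evaluated at $x-h\,\cdot$. In the degenerate case $n=i=0$, $\alpha+\beta=-1$, the product $(\alpha+\beta+1)\Gamma(\alpha+\beta+1)$ in $C_{\alpha,\beta,0,0}$ is read as its continuous extension $\Gamma(\alpha+\beta+2)=1$. *)

theory Defs
  imports "HOL-Analysis.Analysis"
begin

text \<open>The class \<open>C\<^sup>n(I)\<close>, for an open set \<open>I\<close>: since \<open>I\<close> is open, iterating \<^const>\<open>deriv\<close> at points
  of \<open>I\<close> only uses the values of \<open>f\<close> on \<open>I\<close>.\<close>

definition Cn_on :: "nat \<Rightarrow> real set \<Rightarrow> (real \<Rightarrow> real) \<Rightarrow> bool" where
  "Cn_on n I f \<longleftrightarrow>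
     (\<forall>k<n. \<forall>x\<in>I. (deriv ^^ k) f field_differentiable (at x)) \<and>
     continuous_on I ((deriv ^^ n) f)"

definition shrunk_interval :: "real set \<Rightarrow> real \<Rightarrow> real set" where
  "shrunk_interval I h = {x \<in> I. {x - h..x} \<subseteq> I}"

definition jacobi_P :: "nat \<Rightarrow> real \<Rightarrow> real \<Rightarrow> real \<Rightarrow> real" where
  "jacobi_P k a b t =
     (\<Sum>j\<le>k. ((real k + a) gchoose j) * ((real k + b) gchoose (k - j)) * (t - 1) ^ (k - j) * t ^ j)"

text \<open>In Isabelle \<open>0 powr a = 0\<close> also for \<open>a \<le> 0\<close>, so for such exponents the value at an endpoint of
  \<open>[0,1]\<close> is not the usual one; the weight only occurs under integrals, where this is immaterial.\<close>

definition jacobi_weight :: "real \<Rightarrow> real \<Rightarrow> real \<Rightarrow> real" where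
  "jacobi_weight a b t = (1 - t) powr a * t powr b"

definition jacobi_inner :: "real \<Rightarrow> real \<Rightarrow> (real \<Rightarrow> real) \<Rightarrow> (real \<Rightarrow> real) \<Rightarrow> real" where
  "jacobi_inner a b g1 g2 = integral {0..1} (\<lambda>t. jacobi_weight a b t * g1 t * g2 t)"

definition jacobi_norm :: "real \<Rightarrow> real \<Rightarrow> (real \<Rightarrow> real) \<Rightarrow> real" where
  "jacobi_norm a b g = sqrt (jacobi_inner a b g g)"

definition jacobi_series :: "real \<Rightarrow> real \<Rightarrow> nat \<Rightarrow> (real \<Rightarrow> real) \<Rightarrow> real \<Rightarrow> real" where
  "jacobi_series a b N g t =
     (\<Sum>i\<le>N. jacobi_inner a b (jacobi_P i a b) g / (jacobi_norm a b (jacobi_P i a b))\<^sup>2 * jacobi_P i a b t)"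

text \<open>\<open>jacobi_Dn n h \<alpha> \<beta> q f x t\<close> is the \<open>q\<close>-th order truncated series
  \<open>D\<^sup>(\<^sup>n\<^sup>)\<^bsub>h,\<alpha>,\<beta>,q\<^esub> f(x - t h)\<close> of \<open>f\<^sup>(\<^sup>n\<^sup>)(x - h \<cdot>)\<close>, and \<open>jacobi_D0 n h \<alpha> \<beta> q f x t\<close> is the
  \<open>(q + n)\<close>-th order truncated series \<open>D\<^sup>(\<^sup>0\<^sup>)\<^bsub>h,\<alpha>,\<beta>,q\<^esub> f(x - t h)\<close> of \<open>f(x - h \<cdot>)\<close>, whose
  notation leaves the dependence on \<open>n\<close> implicit.\<close>

definition jacobi_Dn ::
  "nat \<Rightarrow> real \<Rightarrow> real \<Rightarrow> real \<Rightarrow> nat \<Rightarrow> (real \<Rightarrow> real) \<Rightarrow> real \<Rightarrow> real \<Rightarrow> real" where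
  "jacobi_Dn n h \<alpha> \<beta> q f x t =
     jacobi_series (\<alpha> + real n) (\<beta> + real n) q (\<lambda>\<tau>. (deriv ^^ n) f (x - h * \<tau>)) t"

definition jacobi_D0 ::
  "nat \<Rightarrow> real \<Rightarrow> real \<Rightarrow> real \<Rightarrow> nat \<Rightarrow> (real \<Rightarrow> real) \<Rightarrow> real \<Rightarrow> real \<Rightarrow> real" where
  "jacobi_D0 n h \<alpha> \<beta> q f x t = jacobi_series \<alpha> \<beta> (q + n) (\<lambda>\<tau>. f (x - h * \<tau>)) t"

text \<open>For \<open>n = i = 0\<close> and \<open>\<alpha> + \<beta> = -1\<close> the product \<open>(\<alpha> + \<beta> + 1) \<Gamma>(\<alpha> + \<beta> + 1)\<close> is read as its
  continuous extension \<open>\<Gamma>(\<alpha> + \<beta> + 2)\<close>; \<^const>\<open>Gamma\<close> is \<open>0\<close> at its poles, so this case has to be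
  singled out.\<close>

definition jacobi_C :: "real \<Rightarrow> real \<Rightarrow> nat \<Rightarrow> nat \<Rightarrow> real" where
  "jacobi_C \<alpha> \<beta> n i =
     (if n = 0 \<and> i = 0 \<and> \<alpha> + \<beta> = -1 then Gamma (\<alpha> + \<beta> + 2)
      else (\<beta> + \<alpha> + 2 * real n + 2 * real i + 1) * Gamma (\<beta> + \<alpha> + 2 * real n + real i + 1))
     * Gamma (real n + real i + 1)
     / (Gamma (\<beta> + real n + real i + 1) * Gamma (\<alpha> + real n + real i + 1))"

definition jacobi_Q :: "real \<Rightarrow> real \<Rightarrow> nat \<Rightarrow> nat \<Rightarrow> real \<Rightarrow> real \<Rightarrow> real" where
  "jacobi_Q \<alpha> \<beta> n q t \<tau> =
     jacobi_weight \<alpha> \<beta> \<tau> *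
     (\<Sum>i\<le>q. jacobi_C \<alpha> \<beta> n i * jacobi_P i (\<alpha> + real n) (\<beta> + real n) t * jacobi_P (n + i) \<alpha> \<beta> \<tau>)"

end

theory Submission
  imports Defs
begin

text \<open>
  Write \<open>P\<close> for \<open>P\<^sub>k\<^bsup>(a+1,b+1)\<^esup>\<close>, \<open>R\<close> for \<open>P\<^sub>k\<^sub>+\<^sub>1\<^bsup>(a,b)\<^esup>\<close>, and \<open>w\<close>, \<open>v\<close> for the weights with
  parameters \<open>(a, b)\<close> and \<open>(a+1, b+1)\<close>. Then \<open>R' = (k+a+b+2) P\<close> and \<open>(v P)' = -(k+1) w R\<close>.
  Since \<open>v\<close> vanishes at \<open>0\<close> and \<open>1\<close>, integration by parts gives
  \<open>\<integral> v P g' = (k+1) \<integral> w R g\<close> for every \<open>C\<^sup>1\<close> function \<open>g\<close>. The choice \<open>g = R\<close> relates the norms of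
  \<open>P\<close> and \<open>R\<close>, so that differentiating the series of \<open>g\<close> term by term gives the series of \<open>g'\<close>, and
  it reduces the computation of the norms to the Beta integral. Iterating \<open>n\<close> times yields both
  claims; orthogonality of the Jacobi polynomials is never needed.
\<close>

section \<open>Recurrences for generalized binomial coefficients\<close>

lemma gbinomial_Suc_mult:
  fixes r :: real
  shows "real (Suc m) * (r gchoose Suc m) = (r - real m) * (r gchoose m)"
  using gbinomial_mult_1[of r m] by (simp add: algebra_simps)

text \<open>Compares coefficients of P_{k+1}^{(a,b)} and P_k^{(a+1,b+1)}. As k + (b + 1) = (k + 1) +
  b, the upper entries agree and only the second lower index moves; \<open>c\<close> stands for the
  first binomial factor, which both coefficients share.\<close>

lemma gbinomial_Suc_mult_right:
  fixes b c :: real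
  assumes "j \<le> k"
  shows "real (Suc k - j) * (c * ((real (Suc k) + b) gchoose (Suc k - j)))
           = (b + 1 + real j) * (c * ((real (Suc k) + b) gchoose (k - j)))"
proof -
  have "real (Suc (k - j)) * ((real (Suc k) + b) gchoose Suc (k - j))
      = (b + 1 + real j) * ((real (Suc k) + b) gchoose (k - j))"
    unfolding gbinomial_Suc_mult using assms by (simp add: of_nat_diff algebra_simps)
  then show ?thesis using assms by (metis Suc_diff_le mult.left_commute)
qed

text \<open>The counterpart for the first lower index: it relates coefficient j + 1 of
  P_{k+1}^{(a,b)} to coefficient j of P_k^{(a+1,b+1)}.\<close>

lemma gbinomial_Suc_mult_left:
  fixes a c :: real
  shows "real (Suc j) * (((real (Suc k) + a) gchoose Suc j) * c)
           = (real k + a + 1 - real j) * (((real (Suc k) + a) gchoose j) * c)"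
proof -
  have "real (Suc j) * ((real (Suc k) + a) gchoose Suc j)
      = (real k + a + 1 - real j) * ((real (Suc k) + a) gchoose j)"
    unfolding gbinomial_Suc_mult by simp
  then show ?thesis by (simp only: mult.assoc[symmetric])
qed

section \<open>Derivatives of Jacobi polynomials, with and without weight\<close>

lemma DERIV_jacobi_P:
  "(jacobi_P k a b has_real_derivative
     (\<Sum>j\<le>k. ((real k + a) gchoose j) * ((real k + b) gchoose (k - j))
        * (real (k - j) * (t - 1) ^ (k - j - 1) * t ^ j
           + (t - 1) ^ (k - j) * (real j * t ^ (j - 1))))) (at t)"
proof -
  have "((\<lambda>t. (t - 1) ^ i * t ^ j) has_real_derivative
      real i * (t - 1) ^ (i - 1) * t ^ j + (t - 1) ^ i * (real j * t ^ (j - 1))) (at t)" for i j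
    by (auto intro!: derivative_eq_intros)
  then show ?thesis
    unfolding jacobi_P_def[abs_def] mult.assoc[of _ "(t - 1) ^ _" for t]
    by (intro DERIV_sum DERIV_cmult)
qed

text \<open>In the derivative, (t - 1)^(k-j) t^j arises once from each factor of the monomials, with
  coefficients (b + 1 + j) \<open>u j\<close> and (k + a + 1 - j) \<open>u j\<close>. Their sum is
  free of j apart from \<open>u j\<close>.\<close>

lemma DERIV_jacobi_P_Suc:
  "(jacobi_P (Suc k) a b has_real_derivative
     (real k + a + b + 2) * jacobi_P k (a + 1) (b + 1) t) (at t)"
proof -
  define c where "c j = ((real (Suc k) + a) gchoose j) * ((real (Suc k) + b) gchoose (Suc k - j))"
    for j
  define u where
    "u j = ((real k + (a + 1)) gchoose j) * ((real k + (b + 1)) gchoose (k - j))" for j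
  have Suc_shift: "real k + (r + 1) = real (Suc k) + r" for r
    by simp
  have D: "(jacobi_P (Suc k) a b has_real_derivative
     (\<Sum>j\<le>Suc k. c j * (real (Suc k - j) * (t - 1) ^ (Suc k - j - 1) * t ^ j
        + (t - 1) ^ (Suc k - j) * (real j * t ^ (j - 1))))) (at t)"
    unfolding c_def by (rule DERIV_jacobi_P)
  \<comment> \<open>The term j = k + 1 vanishes through the factor \<open>Suc k - j\<close>. In
    \<open>B\<close> below it is the term j = 0 that vanishes, which permits the index
    shift.\<close>
  have A: "(\<Sum>j\<le>Suc k. c j * (real (Suc k - j) * (t - 1) ^ (Suc k - j - 1) * t ^ j))
      = (\<Sum>j\<le>k. (b + 1 + real j) * u j * (t - 1) ^ (k - j) * t ^ j)"
  proof -
    have "c j * (real (Suc k - j) * (t - 1) ^ (Suc k - j - 1) * t ^ j)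
        = (b + 1 + real j) * u j * (t - 1) ^ (k - j) * t ^ j" if "j \<le> k" for j
    proof -
      have "real (Suc k - j) * c j = (b + 1 + real j) * u j"
        unfolding c_def u_def Suc_shift by (rule gbinomial_Suc_mult_right[OF that])
      then show ?thesis using that by (simp add: Suc_diff_le mult_ac)
    qed
    then have "(\<Sum>j\<le>k. c j * (real (Suc k - j) * (t - 1) ^ (Suc k - j - 1) * t ^ j))
        = (\<Sum>j\<le>k. (b + 1 + real j) * u j * (t - 1) ^ (k - j) * t ^ j)"
      by (intro sum.cong refl) (simp only: atMost_iff)
    then show ?thesis by simp
  qed
  have B: "(\<Sum>j\<le>Suc k. c j * ((t - 1) ^ (Suc k - j) * (real j * t ^ (j - 1))))
      = (\<Sum>j\<le>k. (real k + a + 1 - real j) * u j * (t - 1) ^ (k - j) * t ^ j)"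
  proof -
    have "c (Suc j) * ((t - 1) ^ (k - j) * (real (Suc j) * t ^ j))
        = (real k + a + 1 - real j) * u j * (t - 1) ^ (k - j) * t ^ j" if "j \<le> k" for j
    proof -
      have "real (Suc j) * c (Suc j) = (real k + a + 1 - real j) * u j"
        unfolding c_def u_def Suc_shift diff_Suc_Suc by (rule gbinomial_Suc_mult_left)
      then show ?thesis by (metis (no_types, lifting) mult.assoc mult.commute)
    qed
    then have "(\<Sum>j\<le>k. c (Suc j) * ((t - 1) ^ (k - j) * (real (Suc j) * t ^ j)))
        = (\<Sum>j\<le>k. (real k + a + 1 - real j) * u j * (t - 1) ^ (k - j) * t ^ j)"
      by (intro sum.cong refl) (simp only: atMost_iff)
    then show ?thesis by (simp add: sum.atMost_Suc_shift del: sum.atMost_Suc of_nat_Suc)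
  qed
  have "(\<Sum>j\<le>Suc k. c j * (real (Suc k - j) * (t - 1) ^ (Suc k - j - 1) * t ^ j
        + (t - 1) ^ (Suc k - j) * (real j * t ^ (j - 1))))
      = (\<Sum>j\<le>k. (real k + a + b + 2) * (u j * (t - 1) ^ (k - j) * t ^ j))"
    unfolding distrib_left sum.distrib A B
    unfolding sum.distrib[symmetric] by (rule sum.cong) (auto simp: algebra_simps)
  also have "\<dots> = (real k + a + b + 2) * jacobi_P k (a + 1) (b + 1) t"
    by (simp add: jacobi_P_def u_def sum_distrib_left)
  finally show ?thesis using D by simp
qed

lemma jacobi_P_0 [simp]: "jacobi_P 0 a b t = 1"
  by (simp add: jacobi_P_def)

lemma jacobi_P_differentiable: "jacobi_P k a b differentiable (at t)"
  using DERIV_jacobi_P real_differentiable_def by blast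

lemma continuous_on_jacobi_P [continuous_intros]: "continuous_on S (jacobi_P k a b)"
  by (meson continuous_at_imp_continuous_on differentiable_imp_continuous_within
      jacobi_P_differentiable)

text \<open>The Rodrigues step \<open>(v P)' = -(k+1) w R\<close>, divided by \<open>w\<close>.\<close>

lemma jacobi_P_rodrigues:
  assumes "(jacobi_P k (a + 1) (b + 1) has_real_derivative p) (at t)"
  shows "((b + 1) * (1 - t) - (a + 1) * t) * jacobi_P k (a + 1) (b + 1) t + t * (1 - t) * p
           = - real (Suc k) * jacobi_P (Suc k) a b t"
proof -
  define c where "c j = ((real (Suc k) + a) gchoose j) * ((real (Suc k) + b) gchoose (Suc k - j))"
    for j
  define u where
    "u j = ((real k + (a + 1)) gchoose j) * ((real k + (b + 1)) gchoose (k - j))" for j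
  have Suc_shift: "real k + (r + 1) = real (Suc k) + r" for r
    by simp
  have "(jacobi_P k (a + 1) (b + 1) has_real_derivative
     (\<Sum>j\<le>k. u j * (real (k - j) * (t - 1) ^ (k - j - 1) * t ^ j
        + (t - 1) ^ (k - j) * (real j * t ^ (j - 1))))) (at t)"
    unfolding u_def by (rule DERIV_jacobi_P)
  with assms have p: "p = (\<Sum>j\<le>k. u j * (real (k - j) * (t - 1) ^ (k - j - 1) * t ^ j
        + (t - 1) ^ (k - j) * (real j * t ^ (j - 1))))"
    using DERIV_unique by blast
  \<comment> \<open>The identity for a single monomial, from 1 - t = -(t - 1). The case split
    settles the truncated exponents \<open>i - 1\<close> and \<open>j - 1\<close> at zero, where the
    factors i and j vanish.\<close>
  have mono: "((b + 1) * (1 - t) - (a + 1) * t) * ((t - 1) ^ i * t ^ j)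
      + t * (1 - t) * (real i * (t - 1) ^ (i - 1) * t ^ j + (t - 1) ^ i * (real j * t ^ (j - 1)))
      = - (b + 1 + real j) * ((t - 1) ^ Suc i * t ^ j)
        - (a + 1 + real i) * ((t - 1) ^ i * t ^ Suc j)" for i j
    by (cases i; cases j) (simp_all add: algebra_simps)
  have "((b + 1) * (1 - t) - (a + 1) * t) * jacobi_P k (a + 1) (b + 1) t + t * (1 - t) * p
      = (\<Sum>j\<le>k. u j * (((b + 1) * (1 - t) - (a + 1) * t) * ((t - 1) ^ (k - j) * t ^ j)
          + t * (1 - t) * (real (k - j) * (t - 1) ^ (k - j - 1) * t ^ j
              + (t - 1) ^ (k - j) * (real j * t ^ (j - 1)))))"
    unfolding p jacobi_P_def u_def[symmetric] sum_distrib_left sum.distrib[symmetric]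
    by (rule sum.cong) (simp_all only: distrib_left mult_ac)
  also have "\<dots> = (\<Sum>j\<le>k. - (b + 1 + real j) * u j * (t - 1) ^ Suc (k - j) * t ^ j)
      + (\<Sum>j\<le>k. - (a + 1 + real (k - j)) * u j * (t - 1) ^ (k - j) * t ^ Suc j)"
  proof -
    have "U * (- B * (x * y) - A * (z * w)) = - B * U * x * y + - A * U * z * w"
      for A B U x y z w :: real
      by (simp add: algebra_simps)
    then show ?thesis unfolding mono sum.distrib[symmetric] by (intro sum.cong refl)
  qed
  \<comment> \<open>This sum gains a zero term at j = k + 1, and the other one, after a shift, at j
    = 0. Both then run over the coefficients \<open>c\<close> of P_{k+1}^{(a,b)}, and their factors
    add up to (k + 1 - j) + j = k + 1.\<close>
  also have "(\<Sum>j\<le>k. - (b + 1 + real j) * u j * (t - 1) ^ Suc (k - j) * t ^ j)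
      = (\<Sum>j\<le>Suc k. - real (Suc k - j) * c j * (t - 1) ^ (Suc k - j) * t ^ j)"
  proof -
    have "(b + 1 + real j) * u j = real (Suc k - j) * c j" if "j \<le> k" for j
      unfolding c_def u_def Suc_shift by (rule gbinomial_Suc_mult_right[OF that, symmetric])
    then have "- (b + 1 + real j) * u j * (t - 1) ^ Suc (k - j) * t ^ j
        = - real (Suc k - j) * c j * (t - 1) ^ (Suc k - j) * t ^ j" if "j \<le> k" for j
      using that by (simp only: Suc_diff_le mult_minus_left)
    then have "(\<Sum>j\<le>k. - (b + 1 + real j) * u j * (t - 1) ^ Suc (k - j) * t ^ j)
        = (\<Sum>j\<le>k. - real (Suc k - j) * c j * (t - 1) ^ (Suc k - j) * t ^ j)"
      by (intro sum.cong refl) (simp only: atMost_iff)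
    then show ?thesis by simp
  qed
  also have "(\<Sum>j\<le>k. - (a + 1 + real (k - j)) * u j * (t - 1) ^ (k - j) * t ^ Suc j)
      = (\<Sum>j\<le>Suc k. - real j * c j * (t - 1) ^ (Suc k - j) * t ^ j)"
  proof -
    have "(a + 1 + real (k - j)) * u j = real (Suc j) * c (Suc j)" if "j \<le> k" for j
    proof -
      have "a + 1 + real (k - j) = real k + a + 1 - real j"
        using that by (simp add: of_nat_diff)
      then show ?thesis
        unfolding c_def u_def Suc_shift diff_Suc_Suc
        by (simp only: gbinomial_Suc_mult_left)
    qed
    then have "(\<Sum>j\<le>k. - (a + 1 + real (k - j)) * u j * (t - 1) ^ (k - j) * t ^ Suc j)
        = (\<Sum>j\<le>k. - real (Suc j) * c (Suc j) * (t - 1) ^ (k - j) * t ^ Suc j)"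
      by (intro sum.cong refl) (simp only: atMost_iff mult_minus_left)
    then show ?thesis by (simp add: sum.atMost_Suc_shift del: sum.atMost_Suc of_nat_Suc)
  qed
  also have "(\<Sum>j\<le>Suc k. - real (Suc k - j) * c j * (t - 1) ^ (Suc k - j) * t ^ j)
      + (\<Sum>j\<le>Suc k. - real j * c j * (t - 1) ^ (Suc k - j) * t ^ j)
      = (\<Sum>j\<le>Suc k. - real (Suc k) * (c j * (t - 1) ^ (Suc k - j) * t ^ j))"
    unfolding sum.distrib[symmetric]
    by (rule sum.cong) (auto simp: of_nat_diff algebra_simps)
  also have "\<dots> = - real (Suc k) * jacobi_P (Suc k) a b t"
    by (simp only: jacobi_P_def c_def sum_distrib_left)
  finally show ?thesis .
qed

text \<open>On the open interval the real powers are differentiable and w_{a+1,b+1} = t (1 - t)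
  w_{a,b}. Factoring w_{a,b} out of the product rule leaves the polynomial identity
  \<open>jacobi_P_rodrigues\<close>.\<close>

lemma DERIV_weight_jacobi_P:
  assumes t: "0 < t" "t < 1"
  shows "((\<lambda>t. jacobi_weight (a + 1) (b + 1) t * jacobi_P k (a + 1) (b + 1) t) has_real_derivative
           - real (Suc k) * (jacobi_weight a b t * jacobi_P (Suc k) a b t)) (at t)"
proof -
  obtain p where p: "(jacobi_P k (a + 1) (b + 1) has_real_derivative p) (at t)"
    using jacobi_P_differentiable real_differentiable_def by blast
  have w: "(jacobi_weight (a + 1) (b + 1) has_real_derivative
        ((b + 1) * (1 - t) - (a + 1) * t) * jacobi_weight a b t) (at t)"
  proof -
    have "((\<lambda>t. (1 - t) powr (a + 1)) has_real_derivative - (a + 1) * (1 - t) powr a) (at t)"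
      using DERIV_fun_powr[of "\<lambda>t. 1 - t" "-1" t "a + 1"] t
        DERIV_diff[OF DERIV_const DERIV_ident, of 1 t] by (simp add: algebra_simps)
    moreover have "((\<lambda>t. t powr (b + 1)) has_real_derivative (b + 1) * t powr b) (at t)"
      using has_real_derivative_powr[of t "b + 1"] t by simp
    ultimately show ?thesis
      using DERIV_mult[of "\<lambda>t. (1 - t) powr (a + 1)" _ t UNIV "\<lambda>t. t powr (b + 1)"] t
      by (fastforce simp: jacobi_weight_def[abs_def] powr_add algebra_simps)
  qed
  have w1: "jacobi_weight (a + 1) (b + 1) t = t * (1 - t) * jacobi_weight a b t"
    using t by (simp add: jacobi_weight_def powr_add)
  have "jacobi_weight (a + 1) (b + 1) t * p
      + ((b + 1) * (1 - t) - (a + 1) * t) * jacobi_weight a b t * jacobi_P k (a + 1) (b + 1) t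
      = jacobi_weight a b t *
        (((b + 1) * (1 - t) - (a + 1) * t) * jacobi_P k (a + 1) (b + 1) t + t * (1 - t) * p)"
    unfolding w1 by (simp only: distrib_left mult_ac add_ac)
  also have "\<dots> = - real (Suc k) * (jacobi_weight a b t * jacobi_P (Suc k) a b t)"
    unfolding jacobi_P_rodrigues[OF p] by simp
  finally show ?thesis using DERIV_mult[OF w p] by (simp only: add.commute mult.commute[of p])
qed

section \<open>Integrals against the weight and integration by parts\<close>

lemma jacobi_weight_has_integral:
  assumes "a > -1" "b > -1"
  shows "(jacobi_weight a b has_integral Beta (a + 1) (b + 1)) {0..1}"
  using has_integral_Beta_real[of "b + 1" "a + 1"] assms
  by (simp add: jacobi_weight_def[abs_def] mult.commute Beta_commute)

text \<open>The weight may be unbounded near 0 and 1, but it is nonnegative and integrable, hence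
  absolutely integrable; a bounded measurable factor preserves this.\<close>

lemma jacobi_weight_mult_integrable:
  assumes "a > -1" "b > -1" and g: "continuous_on {0..1} g"
  shows "(\<lambda>t. jacobi_weight a b t * g t) integrable_on {0..1}"
proof -
  have "jacobi_weight a b absolutely_integrable_on {0..1}"
    using jacobi_weight_has_integral[OF assms(1,2)]
    by (intro nonnegative_absolutely_integrable_1) (auto simp: jacobi_weight_def)
  moreover have "bounded (g ` {0..1})"
    using g by (simp add: compact_continuous_image compact_imp_bounded)
  moreover have "g \<in> borel_measurable (lebesgue_on {0..1})"
    using g by (simp add: continuous_imp_measurable_on_sets_lebesgue)
  ultimately have "(\<lambda>t. g t * jacobi_weight a b t) absolutely_integrable_on {0..1}"
    by (intro absolutely_integrable_bounded_measurable_product_real) auto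
  then show ?thesis
    by (simp add: mult.commute absolutely_integrable_on_def)
qed

lemma jacobi_inner_integrable:
  assumes "a > -1" "b > -1" "continuous_on {0..1} g"
  shows "(\<lambda>t. jacobi_weight a b t * jacobi_P k a b t * g t) integrable_on {0..1}"
  unfolding mult.assoc by (intro jacobi_weight_mult_integrable continuous_intros assms)

lemma continuous_on_jacobi_weight:
  assumes "a > 0" "b > 0"
  shows "continuous_on {0..1} (jacobi_weight a b)"
  unfolding jacobi_weight_def[abs_def]
  using assms by (intro continuous_intros continuous_on_powr') auto

lemma jacobi_inner_deriv:
  assumes ab: "a > -1" "b > -1"
    and g: "\<And>t. t \<in> {0..1} \<Longrightarrow> (g has_real_derivative g' t) (at t)"
    and g': "continuous_on {0..1} g'"
  shows "jacobi_inner (a + 1) (b + 1) (jacobi_P k (a + 1) (b + 1)) g'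
           = real (Suc k) * jacobi_inner a b (jacobi_P (Suc k) a b) g"
proof -
  define F where
    "F = (\<lambda>t. jacobi_weight (a + 1) (b + 1) t * jacobi_P k (a + 1) (b + 1) t * g t)"
  have gc: "continuous_on {0..1} g"
    using g by (meson DERIV_isCont continuous_at_imp_continuous_on)
  define u where "u = (\<lambda>t. jacobi_weight a b t * jacobi_P (Suc k) a b t * g t)"
  define v where
    "v = (\<lambda>t. jacobi_weight (a + 1) (b + 1) t * jacobi_P k (a + 1) (b + 1) t * g' t)"
  \<comment> \<open>\<open>F\<close> is continuous up to the endpoints because a + 1 and b + 1 are
    positive, but the derivative formula is available only inside; hence the interior form of the
    fundamental theorem.\<close>
  have "((\<lambda>t. v t - real (Suc k) * u t) has_integral F 1 - F 0) {0..1}"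
  proof (rule fundamental_theorem_of_calculus_interior)
    show "continuous_on {0..1} F"
      unfolding F_def using ab gc by (intro continuous_intros continuous_on_jacobi_weight) auto
    fix t :: real assume "t \<in> {0<..<1}"
    then have t: "0 < t" "t < 1" by auto
    show "(F has_vector_derivative v t - real (Suc k) * u t) (at t)"
      using DERIV_mult[OF DERIV_weight_jacobi_P[OF t, of a b k] g[of t]] t
      by (simp add: F_def u_def v_def has_real_derivative_iff_has_vector_derivative[symmetric]
          algebra_simps)
  qed simp
  moreover have "F 1 - F 0 = 0"
    using ab by (simp add: F_def jacobi_weight_def)
  ultimately have "integral {0..1} (\<lambda>t. v t - real (Suc k) * u t) = 0"
    by (simp add: integral_unique)
  moreover have "u integrable_on {0..1}"
    unfolding u_def by (rule jacobi_inner_integrable[OF ab gc])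
  moreover have "v integrable_on {0..1}"
    unfolding v_def using ab g' by (intro jacobi_inner_integrable) auto
  ultimately have "integral {0..1} v = real (Suc k) * integral {0..1} u"
    by (subst (asm) integral_diff) (auto intro!: integrable_on_mult_right simp del: of_nat_Suc)
  then show ?thesis by (simp add: jacobi_inner_def u_def v_def)
qed

section \<open>Norms of the Jacobi polynomials\<close>

lemma jacobi_inner_mult_right:
  "jacobi_inner a b p (\<lambda>t. c * g t) = c * jacobi_inner a b p g"
  by (simp add: jacobi_inner_def mult.left_commute[of _ c])

text \<open>Integration by parts with g = P_{k+1}^{(a,b)}, whose derivative is a multiple of
  P_k^{(a+1,b+1)}.\<close>

lemma jacobi_norm_Suc:
  assumes "a > -1" "b > -1"
  shows "(real k + a + b + 2)
           * jacobi_inner (a + 1) (b + 1) (jacobi_P k (a + 1) (b + 1)) (jacobi_P k (a + 1) (b + 1))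
         = real (Suc k) * jacobi_inner a b (jacobi_P (Suc k) a b) (jacobi_P (Suc k) a b)"
proof -
  have "jacobi_inner (a + 1) (b + 1) (jacobi_P k (a + 1) (b + 1))
        (\<lambda>t. (real k + a + b + 2) * jacobi_P k (a + 1) (b + 1) t)
      = real (Suc k) * jacobi_inner a b (jacobi_P (Suc k) a b) (jacobi_P (Suc k) a b)"
    by (intro jacobi_inner_deriv DERIV_jacobi_P_Suc continuous_intros assms)
  then show ?thesis unfolding jacobi_inner_mult_right .
qed

lemma jacobi_norm_power2:
  assumes "a > -1" "b > -1"
  shows "(jacobi_norm a b (jacobi_P k a b))\<^sup>2 = jacobi_inner a b (jacobi_P k a b) (jacobi_P k a b)"
proof -
  have "0 \<le> jacobi_inner a b (jacobi_P k a b) (jacobi_P k a b)"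
    unfolding jacobi_inner_def
    by (intro integral_nonneg jacobi_inner_integrable assms continuous_intros)
       (simp add: jacobi_weight_def mult.assoc)
  then show ?thesis by (simp add: jacobi_norm_def)
qed

text \<open>\<open>jacobi_C\<close> with n = 0 is the reciprocal of the squared norm. The induction
  lowers the degree while raising both parameters by 1, down to the Beta integral at degree 0. The
  product form also shows that the norm is nonzero.\<close>

lemma jacobi_norm_mult_C:
  assumes "a > -1" "b > -1"
  shows "jacobi_inner a b (jacobi_P k a b) (jacobi_P k a b) * jacobi_C a b 0 k = 1"
  using assms
proof (induction k arbitrary: a b)
  case 0
  have inner: "jacobi_inner a b (jacobi_P 0 a b) (jacobi_P 0 a b) = Beta (a + 1) (b + 1)"
    using jacobi_weight_has_integral[OF 0] by (simp add: jacobi_inner_def integral_unique)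
  \<comment> \<open>Since a + b + 1 > -1, the only pole of \<open>Gamma\<close> that can occur is at
    0, which is exactly the case singled out in \<open>jacobi_C\<close>.\<close>
  have "(a + b + 1) * Gamma (a + b + 1) = Gamma (a + b + 2)" if "a + b \<noteq> -1"
  proof -
    have "a + b + 1 \<notin> \<int>\<^sub>\<le>\<^sub>0"
    proof
      assume "a + b + 1 \<in> \<int>\<^sub>\<le>\<^sub>0"
      then obtain m where "a + b + 1 = real_of_int m" "m \<le> 0" by (elim nonpos_Ints_cases)
      with that 0 show False by (cases "m = 0") auto
    qed
    then show ?thesis using Gamma_plus1[of "a + b + 1"] by (simp add: algebra_simps)
  qed
  then have C: "jacobi_C a b 0 0 = Gamma (a + b + 2) / (Gamma (a + 1) * Gamma (b + 1))"
    unfolding jacobi_C_def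
    by (cases "a + b = -1")
       (simp_all add: add.commute[of b a] mult.commute[of "Gamma (b + 1)" "Gamma (a + 1)"])
  have "Gamma (a + 1) > 0" "Gamma (b + 1) > 0" "Gamma (a + b + 2) > 0"
    using 0 by (auto intro!: Gamma_real_pos)
  then show ?case unfolding inner C by (simp add: Beta_def add_ac)
next
  case (Suc k)
  let ?N = "jacobi_inner a b (jacobi_P (Suc k) a b) (jacobi_P (Suc k) a b)"
  let ?M = "jacobi_inner (a + 1) (b + 1) (jacobi_P k (a + 1) (b + 1)) (jacobi_P k (a + 1) (b + 1))"
  have s: "real k + a + b + 2 > 0" using Suc.prems by simp
  then have "real k + a + b + 2 \<notin> \<int>\<^sub>\<le>\<^sub>0" by (auto elim!: nonpos_Ints_cases)
  then have "Gamma (real k + a + b + 3) = (real k + a + b + 2) * Gamma (real k + a + b + 2)"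
    using Gamma_plus1[of "real k + a + b + 2"] by (simp add: algebra_simps)
  moreover have "Gamma (real k + 2) = (real k + 1) * Gamma (real k + 1)"
    using Gamma_fact[of k, where 'a = real] Gamma_fact[of "Suc k", where 'a = real]
    by (simp add: add_ac)
  \<comment> \<open>Neither side meets the exceptional branch of \<open>jacobi_C\<close>: on the
    left the index is positive, and on the right the branch would require a + b = -3.\<close>
  ultimately have C: "(real k + a + b + 2) * jacobi_C a b 0 (Suc k)
      = real (Suc k) * jacobi_C (a + 1) (b + 1) 0 k"
    using Suc.prems by (simp add: jacobi_C_def add_ac mult_ac)
  have "(real k + a + b + 2) * real (Suc k) * (?N * jacobi_C a b 0 (Suc k))
      = (real (Suc k) * ?N) * ((real k + a + b + 2) * jacobi_C a b 0 (Suc k))"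
    by (simp only: mult_ac)
  also have "\<dots> = (real k + a + b + 2) * real (Suc k) * (?M * jacobi_C (a + 1) (b + 1) 0 k)"
    unfolding C jacobi_norm_Suc[OF Suc.prems, symmetric] by (simp only: mult_ac)
  also have "?M * jacobi_C (a + 1) (b + 1) 0 k = 1"
    using Suc.prems by (intro Suc.IH) auto
  finally show ?case using s by simp
qed

section \<open>Differentiating truncated Jacobi series\<close>

lemma DERIV_jacobi_series:
  assumes ab: "a > -1" "b > -1"
    and g: "\<And>t. t \<in> {0..1} \<Longrightarrow> (g has_real_derivative g' t) (at t)"
    and g': "continuous_on {0..1} g'"
  shows "(jacobi_series a b (Suc N) g has_real_derivative jacobi_series (a + 1) (b + 1) N g' t) (at t)"
proof -
  have eq: "jacobi_inner a b (jacobi_P (Suc i) a b) g / (jacobi_norm a b (jacobi_P (Suc i) a b))\<^sup>2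
        * (real i + a + b + 2)
      = jacobi_inner (a + 1) (b + 1) (jacobi_P i (a + 1) (b + 1)) g'
        / (jacobi_norm (a + 1) (b + 1) (jacobi_P i (a + 1) (b + 1)))\<^sup>2" for i
  proof -
    have s: "real i + a + b + 2 > 0" using ab by simp
    have IP: "jacobi_inner (a + 1) (b + 1) (jacobi_P i (a + 1) (b + 1)) g'
        = real (Suc i) * jacobi_inner a b (jacobi_P (Suc i) a b) g"
      by (intro jacobi_inner_deriv ab g g')
    \<comment> \<open>Expanding the fraction by i + 1 makes \<open>IP\<close> apply to the numerator
      and \<open>jacobi_norm_Suc\<close> to the denominator; the factor i + a + b + 2 then
      cancels.\<close>
    have "jacobi_inner a b (jacobi_P (Suc i) a b) g
          / jacobi_inner a b (jacobi_P (Suc i) a b) (jacobi_P (Suc i) a b) * (real i + a + b + 2)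
        = (real (Suc i) * jacobi_inner a b (jacobi_P (Suc i) a b) g)
          / (real (Suc i) * jacobi_inner a b (jacobi_P (Suc i) a b) (jacobi_P (Suc i) a b))
          * (real i + a + b + 2)"
      by (simp del: of_nat_Suc)
    also have "\<dots> = jacobi_inner (a + 1) (b + 1) (jacobi_P i (a + 1) (b + 1)) g'
        / jacobi_inner (a + 1) (b + 1) (jacobi_P i (a + 1) (b + 1)) (jacobi_P i (a + 1) (b + 1))"
      unfolding jacobi_norm_Suc[OF ab, symmetric] IP[symmetric] using s by simp
    finally show ?thesis using ab by (simp add: jacobi_norm_power2)
  qed
  define c where "c i = jacobi_inner a b (jacobi_P i a b) g / (jacobi_norm a b (jacobi_P i a b))\<^sup>2"
    for i
  have "((\<lambda>t. c 0 + (\<Sum>i\<le>N. c (Suc i) * jacobi_P (Suc i) a b t)) has_real_derivative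
      0 + (\<Sum>i\<le>N. c (Suc i) * ((real i + a + b + 2) * jacobi_P i (a + 1) (b + 1) t))) (at t)"
    by (intro DERIV_add DERIV_const DERIV_sum DERIV_cmult DERIV_jacobi_P_Suc)
  also have "(\<lambda>t. c 0 + (\<Sum>i\<le>N. c (Suc i) * jacobi_P (Suc i) a b t)) = jacobi_series a b (Suc N) g"
    by (simp add: jacobi_series_def c_def fun_eq_iff sum.atMost_Suc_shift del: sum.atMost_Suc)
  also have "0 + (\<Sum>i\<le>N. c (Suc i) * ((real i + a + b + 2) * jacobi_P i (a + 1) (b + 1) t))
      = jacobi_series (a + 1) (b + 1) N g' t"
    unfolding jacobi_series_def c_def mult.assoc[symmetric] eq by simp
  finally show ?thesis .
qed

text \<open>\<open>G k\<close> plays the role of the k-th derivative of \<open>G 0\<close>; a family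
  leaves room for chain rule factors. Both claims share one induction, whose step replaces (a, b, G)
  by (a + 1, b + 1, G shifted by one). The factorials collect the factors i + 1, ..., i + n.\<close>

lemma
  fixes G :: "nat \<Rightarrow> real \<Rightarrow> real"
  assumes "a > -1" "b > -1"
    and "\<And>k t. \<lbrakk>k < n; t \<in> {0..1}\<rbrakk> \<Longrightarrow> (G k has_real_derivative G (Suc k) t) (at t)"
    and "continuous_on {0..1} (G n)"
  shows higher_deriv_jacobi_series:
      "(deriv ^^ n) (jacobi_series a b (q + n) (G 0)) = jacobi_series (a + real n) (b + real n) q (G n)"
    and jacobi_inner_higher_deriv:
      "fact i * jacobi_inner (a + real n) (b + real n) (jacobi_P i (a + real n) (b + real n)) (G n)
        = fact (n + i) * jacobi_inner a b (jacobi_P (n + i) a b) (G 0)"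
proof -
  have "(deriv ^^ n) (jacobi_series a b (q + n) (G 0)) = jacobi_series (a + real n) (b + real n) q (G n)
    \<and> fact i * jacobi_inner (a + real n) (b + real n) (jacobi_P i (a + real n) (b + real n)) (G n)
        = fact (n + i) * jacobi_inner a b (jacobi_P (n + i) a b) (G 0)"
    using assms
  proof (induction n arbitrary: a b G)
    case 0
    then show ?case by simp
  next
    case (Suc n)
    have G0: "(G 0 has_real_derivative G 1 t) (at t)" if "t \<in> {0..1}" for t
      using Suc.prems(3)[of 0 t] that by simp
    \<comment> \<open>\<open>G 1\<close> is either the last function, continuous by assumption, or
      itself differentiable.\<close>
    have G1: "continuous_on {0..1} (G 1)"
    proof (cases n)
      case 0
      then show ?thesis using Suc.prems(4) by simp
    next
      case (Suc m)
      then have "isCont (G 1) t" if "t \<in> {0..1}" for t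
        using Suc.prems(3)[of 1 t] that DERIV_isCont by simp
      then show ?thesis by (simp add: continuous_at_imp_continuous_on)
    qed
    \<comment> \<open>An equality of functions on the whole line, as the series are polynomials in
      t; this is what lets \<open>deriv\<close> be iterated.\<close>
    have "deriv (jacobi_series a b (q + Suc n) (G 0)) = jacobi_series (a + 1) (b + 1) (q + n) (G 1)"
      using DERIV_jacobi_series[OF Suc.prems(1,2) G0 G1, of "q + n"]
      by (intro ext DERIV_imp_deriv) simp
    moreover have
      "fact (n + i) * jacobi_inner (a + 1) (b + 1) (jacobi_P (n + i) (a + 1) (b + 1)) (G 1)
        = fact (Suc n + i) * jacobi_inner a b (jacobi_P (Suc n + i) a b) (G 0)"
    proof -
      have "jacobi_inner (a + 1) (b + 1) (jacobi_P (n + i) (a + 1) (b + 1)) (G 1)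
          = real (Suc (n + i)) * jacobi_inner a b (jacobi_P (Suc (n + i)) a b) (G 0)"
        by (intro jacobi_inner_deriv Suc.prems(1,2) G0 G1)
      then show ?thesis by simp
    qed
    moreover note Suc.IH[of "a + 1" "b + 1" "\<lambda>k. G (Suc k)"]
    ultimately show ?case using Suc.prems
      by (simp add: funpow_swap1 add_ac)
  qed
  then show
    "(deriv ^^ n) (jacobi_series a b (q + n) (G 0)) = jacobi_series (a + real n) (b + real n) q (G n)"
    "fact i * jacobi_inner (a + real n) (b + real n) (jacobi_P i (a + real n) (b + real n)) (G n)
        = fact (n + i) * jacobi_inner a b (jacobi_P (n + i) a b) (G 0)"
    by auto
qed

section \<open>The constants and the integral representation\<close>

text \<open>The two constants differ only in the factors Gamma(n + i + 1) = (n + i)! and Gamma(i +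
  1) = i!. For n > 0 neither is exceptional, since a + b + 2n > 0.\<close>

lemma jacobi_C_shift:
  assumes "a > -1" "b > -1"
  shows "fact i * jacobi_C a b n i = fact (n + i) * jacobi_C (a + real n) (b + real n) 0 i"
proof (cases n)
  case 0
  then show ?thesis by simp
next
  case (Suc m)
  have "Gamma (real n + real i + 1) = fact (n + i)" "Gamma (real i + 1) = fact i"
    using Gamma_fact[of "n + i", where 'a = real] Gamma_fact[of i, where 'a = real]
    by (simp_all add: add_ac)
  moreover have "a + real n + (b + real n) \<noteq> -1" "n \<noteq> 0"
    using assms Suc by auto
  ultimately show ?thesis
    unfolding jacobi_C_def by (simp add: add_ac mult_ac)
qed

lemma jacobi_series_scale: "jacobi_series a b N (\<lambda>t. c * g t) t = c * jacobi_series a b N g t"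
  by (simp add: jacobi_series_def jacobi_inner_mult_right sum_distrib_left mult.assoc)

theorem lemma1:
  fixes n q :: nat and \<alpha> \<beta> h :: real and I :: "real set" and f :: "real \<Rightarrow> real"
  assumes "\<alpha> > -1" and "\<beta> > -1" and "h > 0"
    and "open I" and "is_interval I"
    and "Cn_on n I f"
  shows "(\<forall>x\<in>shrunk_interval I h. \<forall>t\<in>{0..1}.
            jacobi_Dn n h \<alpha> \<beta> q f x t
              = 1 / (- h) ^ n * (deriv ^^ n) (\<lambda>s. jacobi_D0 n h \<alpha> \<beta> q f x s) t)
       \<and> (\<forall>x\<in>shrunk_interval I h. \<forall>t\<in>{0..1}.
            jacobi_Dn n h \<alpha> \<beta> q f x t
              = 1 / (- h) ^ n * integral {0..1} (\<lambda>\<tau>. jacobi_Q \<alpha> \<beta> n q t \<tau> * f (x - h * \<tau>)))"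
proof -
  have main: "jacobi_Dn n h \<alpha> \<beta> q f x t
        = 1 / (- h) ^ n * (deriv ^^ n) (\<lambda>s. jacobi_D0 n h \<alpha> \<beta> q f x s) t
      \<and> jacobi_Dn n h \<alpha> \<beta> q f x t
        = 1 / (- h) ^ n * integral {0..1} (\<lambda>\<tau>. jacobi_Q \<alpha> \<beta> n q t \<tau> * f (x - h * \<tau>))"
    if x: "x \<in> shrunk_interval I h" for x t
  proof -
    \<comment> \<open>The k-th derivative of \<open>f (x - h * \<tau>)\<close> in \<tau>; the chain
      rule contributes the power of -h.\<close>
    define G where "G k \<tau> = (- h) ^ k * (deriv ^^ k) f (x - h * \<tau>)" for k \<tau>
    have in_I: "x - h * \<tau> \<in> I" if "\<tau> \<in> {0..1}" for \<tau>
    proof -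
      have "h * \<tau> \<le> h * 1" using that assms(3) by (intro mult_left_mono) auto
      then have "x - h * \<tau> \<in> {x - h..x}" using that assms(3) by simp
      then show ?thesis using x by (auto simp: shrunk_interval_def)
    qed
    have G: "(G k has_real_derivative G (Suc k) \<tau>) (at \<tau>)" if "k < n" "\<tau> \<in> {0..1}" for k \<tau>
    proof -
      have "((deriv ^^ k) f has_real_derivative (deriv ^^ Suc k) f (x - h * \<tau>)) (at (x - h * \<tau>))"
        using assms(6) that in_I[of \<tau>] by (simp add: Cn_on_def DERIV_deriv_iff_field_differentiable)
      then have "((\<lambda>s. (deriv ^^ k) f (x - h * s)) has_real_derivative
          (deriv ^^ Suc k) f (x - h * \<tau>) * (- h)) (at \<tau>)"
        by (rule DERIV_chain2) (auto intro!: derivative_eq_intros)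
      from DERIV_cmult[OF this, of "(- h) ^ k"] show ?thesis
        unfolding G_def[abs_def] by (simp add: mult_ac)
    qed
    have "continuous_on {0..1} (\<lambda>\<tau>. (deriv ^^ n) f (x - h * \<tau>))"
      using assms(6) in_I unfolding Cn_on_def
      by (intro continuous_on_compose2[of I "(deriv ^^ n) f" _ "\<lambda>\<tau>. x - h * \<tau>"])
         (auto intro!: continuous_on_diff continuous_on_mult_left continuous_on_id)
    then have Gn: "continuous_on {0..1} (G n)"
      unfolding G_def[abs_def] by (intro continuous_intros)
    have G0c: "continuous_on {0..1} (G 0)"
    proof (cases n)
      case 0
      then show ?thesis using Gn by simp
    next
      case (Suc m)
      then have "isCont (G 0) \<tau>" if "\<tau> \<in> {0..1}" for \<tau>
        using G[of 0 \<tau>] that DERIV_isCont by simp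
      then show ?thesis by (simp add: continuous_at_imp_continuous_on)
    qed
    have G0: "G 0 = (\<lambda>\<tau>. f (x - h * \<tau>))" by (simp add: G_def fun_eq_iff)
    define A B where "A = \<alpha> + real n" and "B = \<beta> + real n"
    have AB: "A > -1" "B > -1" using assms(1,2) by (auto simp: A_def B_def)
    have Dn: "jacobi_Dn n h \<alpha> \<beta> q f x t = 1 / (- h) ^ n * jacobi_series A B q (G n) t"
      using assms(3) unfolding jacobi_Dn_def G_def[abs_def] jacobi_series_scale
      by (simp add: A_def B_def)
    have "jacobi_series A B q (G n) = (deriv ^^ n) (\<lambda>s. jacobi_D0 n h \<alpha> \<beta> q f x s)"
      using higher_deriv_jacobi_series[of \<alpha> \<beta> n G q, OF assms(1,2) G Gn]
      by (simp add: jacobi_D0_def[abs_def] G0 A_def B_def)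
    moreover have "jacobi_series A B q (G n) t
        = integral {0..1} (\<lambda>\<tau>. jacobi_Q \<alpha> \<beta> n q t \<tau> * f (x - h * \<tau>))"
    proof -
      \<comment> \<open>The inner product with the n-th derivative becomes one with \<open>f\<close>
        by n integrations by parts, and the norm becomes a constant by
        \<open>jacobi_norm_mult_C\<close>. The quotient of factorials is absorbed by
        \<open>jacobi_C_shift\<close>.\<close>
      have coeff: "jacobi_inner A B (jacobi_P i A B) (G n) / (jacobi_norm A B (jacobi_P i A B))\<^sup>2
          = jacobi_C \<alpha> \<beta> n i * jacobi_inner \<alpha> \<beta> (jacobi_P (n + i) \<alpha> \<beta>) (G 0)" for i
      proof -
        have "1 / jacobi_inner A B (jacobi_P i A B) (jacobi_P i A B) = jacobi_C A B 0 i"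
          using jacobi_norm_mult_C[OF AB, of i]
          by (metis mult_zero_left nonzero_mult_div_cancel_left zero_neq_one)
        then have "fact i * (jacobi_inner A B (jacobi_P i A B) (G n)
              / (jacobi_norm A B (jacobi_P i A B))\<^sup>2)
            = (fact i * jacobi_inner A B (jacobi_P i A B) (G n)) * jacobi_C A B 0 i"
          unfolding jacobi_norm_power2[OF AB] by (metis times_divide_eq_right mult.right_neutral mult.assoc)
        also have "\<dots> = fact (n + i) * jacobi_C A B 0 i
            * jacobi_inner \<alpha> \<beta> (jacobi_P (n + i) \<alpha> \<beta>) (G 0)"
          using jacobi_inner_higher_deriv[of \<alpha> \<beta> n G i, OF assms(1,2) G Gn]
          by (simp add: A_def B_def)
        also have "\<dots> = fact i * (jacobi_C \<alpha> \<beta> n i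
            * jacobi_inner \<alpha> \<beta> (jacobi_P (n + i) \<alpha> \<beta>) (G 0))"
          using jacobi_C_shift[OF assms(1,2), of i n] by (simp add: A_def B_def)
        finally show ?thesis by (simp only: mult_cancel_left fact_nonzero simp_thms)
      qed
      have Q: "(\<lambda>\<tau>. jacobi_Q \<alpha> \<beta> n q t \<tau> * f (x - h * \<tau>))
          = (\<lambda>\<tau>. \<Sum>i\<le>q. jacobi_C \<alpha> \<beta> n i * jacobi_P i A B t
              * (jacobi_weight \<alpha> \<beta> \<tau> * jacobi_P (n + i) \<alpha> \<beta> \<tau> * G 0 \<tau>))"
        by (simp add: jacobi_Q_def G0 A_def B_def sum_distrib_left sum_distrib_right mult_ac)
      have "integral {0..1} (\<lambda>\<tau>. jacobi_Q \<alpha> \<beta> n q t \<tau> * f (x - h * \<tau>))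
          = (\<Sum>i\<le>q. jacobi_C \<alpha> \<beta> n i * jacobi_P i A B t
              * jacobi_inner \<alpha> \<beta> (jacobi_P (n + i) \<alpha> \<beta>) (G 0))"
      proof -
        have "(\<lambda>\<tau>. jacobi_weight \<alpha> \<beta> \<tau> * jacobi_P (n + i) \<alpha> \<beta> \<tau> * G 0 \<tau>) integrable_on {0..1}" for i
          by (rule jacobi_inner_integrable[OF assms(1,2) G0c])
        then show ?thesis
          unfolding Q by (subst integral_sum)
             (simp_all only: finite_atMost integrable_on_mult_right integral_mult_right jacobi_inner_def)
      qed
      then show ?thesis
        unfolding jacobi_series_def coeff by (simp only: mult_ac)
    qed
    ultimately show ?thesis using Dn by simp
  qed
  then show ?thesis by blast
qed

end
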